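(* Let $m\ge 2$, let $n$ be an even positive integer, and let $r$ be an integer with $n>r\ge 0$. Then $\chi_{la}(A(mK_{n+1},K_{r+1}))=\chi_{la}(A(mK_n,K_r)\vee K_1)=n+1$.
   Context: All graphs are finite and simple. For a graph $G$ with $q$ edges, a local antimagic labeling of $G$ is a bijection $g:E(G)\to\{1,2,\ldots,q\}$ such that $g^+(u)\neq g^+(v)$ for every edge $uv\in E(G)$, where $g^+(u)$ is the sum of $g(e)$ over all edges $e$ incident to $u$. The local antimagic chromatic number $\chi_{la}(G)$ is the minimum, over all local antimagic labelings $g$ of $G$, of the number of distinct values of $g^+$ on $V(G)$. (It is known that every connected graph of order at least 3 has a local antimagic labeling.) For a graph $G$, $G\vee K_1$ is the graph obtained from $G$ by joining a new vertex to every vertex of $G$. For $m\ge 2$ and $n>r\ge 1$, $A(mK_n,K_r)$ denotes the amalgamation of $m$ copies of the complete graph $K_n$ over $K_r$: the simple graph obtained from $m$ copies of $K_n$ by choosing a $K_r$ in each copy and identifying these $m$ copies of $K_r$ into a single $K_r$. Equivalently, it is the join $(mK_{n-r})\vee K_r$, where $mK_{n-r}$ is the disjoint union of $m$ copies of $K_{n-r}$. By convention $A(mK_n,K_0)=mK_n$, the disjoint union of $m$ copies of $K_n$. *)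

theory Defs
  imports Main
begin

text \<open>A graph is a pair of a vertex set and a set of edges, each edge being the set of its two
  endpoints.\<close>

type_synonym 'a ugraph = "'a set \<times> 'a set set"

definition verts :: "'a ugraph \<Rightarrow> 'a set" where
  "verts G = fst G"

definition edges :: "'a ugraph \<Rightarrow> 'a set set" where
  "edges G = snd G"

definition finite_simple_graph :: "'a ugraph \<Rightarrow> bool" where
  "finite_simple_graph G \<longleftrightarrow>
     finite (verts G) \<and> (\<forall>e \<in> edges G. e \<subseteq> verts G \<and> card e = 2)"

definition vertex_sum :: "'a ugraph \<Rightarrow> ('a set \<Rightarrow> nat) \<Rightarrow> 'a \<Rightarrow> nat" where
  "vertex_sum G g u = (\<Sum>e \<in> {e \<in> edges G. u \<in> e}. g e)"

definition local_antimagic_labeling :: "'a ugraph \<Rightarrow> ('a set \<Rightarrow> nat) \<Rightarrow> bool" where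
  "local_antimagic_labeling G g \<longleftrightarrow>
     bij_betw g (edges G) {1..card (edges G)} \<and>
     (\<forall>u v. {u, v} \<in> edges G \<longrightarrow> vertex_sum G g u \<noteq> vertex_sum G g v)"

text \<open>The infimum of a nonempty set of naturals is its minimum. On naturals \<open>Inf {} = 0\<close>, so a
  graph with vertices but without a local antimagic labeling gets the value 0, which no labeling
  of it can attain.\<close>

definition chi_la :: "'a ugraph \<Rightarrow> nat" where
  "chi_la G = Inf {card (vertex_sum G g ` verts G) | g. local_antimagic_labeling G g}"

definition complete_graph :: "nat \<Rightarrow> nat ugraph" where
  "complete_graph n = ({..<n}, {e. e \<subseteq> {..<n} \<and> card e = 2})"

definition disjoint_copies :: "nat \<Rightarrow> 'a ugraph \<Rightarrow> (nat \<times> 'a) ugraph" where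
  "disjoint_copies m G =
     ({..<m} \<times> verts G, {Pair i ` e | i e. i < m \<and> e \<in> edges G})"

text \<open>Image of a graph under a vertex map; vertices with the same image are identified, and
  so are edges that become parallel.\<close>

definition map_graph :: "('a \<Rightarrow> 'b) \<Rightarrow> 'a ugraph \<Rightarrow> 'b ugraph" where
  "map_graph f G = (f ` verts G, image f ` edges G)"

definition graph_join :: "'a ugraph \<Rightarrow> 'b ugraph \<Rightarrow> ('a + 'b) ugraph" where
  "graph_join G H =
     (verts G <+> verts H,
      image Inl ` edges G \<union> image Inr ` edges H \<union>
      {{Inl u, Inr v} | u v. u \<in> verts G \<and> v \<in> verts H})"

text \<open>\<open>A(mK\<^sub>n, K\<^sub>r)\<close> for \<open>r \<le> n\<close>. The vertex \<open>(i, j)\<close> is vertex \<open>j\<close> of the \<open>i\<close>-th copy of \<open>K\<^sub>n\<close>;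
  the \<open>K\<^sub>r\<close> chosen in each copy is the one on \<open>j < r\<close>, and all of these are identified with the
  one in copy 0.\<close>

definition amalgamation :: "nat \<Rightarrow> nat \<Rightarrow> nat \<Rightarrow> (nat \<times> nat) ugraph" where
  "amalgamation m n r =
     map_graph (\<lambda>(i, j). if j < r then (0, j) else (i, j))
       (disjoint_copies m (complete_graph n))"

lemma finite_simple_graph_complete: "finite_simple_graph (complete_graph n)"
  by (auto simp: finite_simple_graph_def complete_graph_def verts_def edges_def)

lemma finite_simple_graph_copies:
  "finite_simple_graph G \<Longrightarrow> finite_simple_graph (disjoint_copies m G)"
  by (auto simp: finite_simple_graph_def disjoint_copies_def verts_def edges_def
      card_image inj_on_def)

lemma finite_simple_graph_amalgamation: "finite_simple_graph (amalgamation m n r)"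
proof -
  let ?f = "\<lambda>(i::nat, j::nat). if j < r then (0, j) else (i, j)"
  have inj: "inj_on ?f (Pair i ` e)" for i e
    by (auto simp: inj_on_def split: if_splits)
  have "finite_simple_graph (disjoint_copies m (complete_graph n))"
    by (simp add: finite_simple_graph_complete finite_simple_graph_copies)
  then have fin: "finite (verts (disjoint_copies m (complete_graph n)))"
    and E: "\<And>e. e \<in> edges (disjoint_copies m (complete_graph n)) \<Longrightarrow>
      e \<subseteq> verts (disjoint_copies m (complete_graph n)) \<and> card e = 2"
    by (auto simp: finite_simple_graph_def)
  have "card (?f ` e) = 2" if "e \<in> edges (disjoint_copies m (complete_graph n))" for e
  proof -
    obtain i e' where "e = Pair i ` e'"
      using \<open>e \<in> _\<close> by (auto simp: disjoint_copies_def edges_def)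
    then show ?thesis using inj E[OF that] by (simp only: card_image)
  qed
  then show ?thesis
    using fin E unfolding finite_simple_graph_def amalgamation_def map_graph_def
    by (simp add: verts_def edges_def) (meson image_mono)
qed

lemma finite_simple_graph_join:
  assumes "finite_simple_graph G" "finite_simple_graph H"
  shows "finite_simple_graph (graph_join G H)"
  using assms by (auto simp: finite_simple_graph_def graph_join_def verts_def edges_def card_image)

lemma amalgamation_0: "amalgamation m n 0 = disjoint_copies m (complete_graph n)"
  by (simp add: amalgamation_def map_graph_def verts_def edges_def)

text \<open>This is the join of \<open>mK\<^bsub>n-r\<^esub>\<close> (the vertices with \<open>j \<ge> r\<close>) and \<open>K\<^sub>r\<close> (those with
  \<open>j < r\<close>).\<close>

lemma verts_amalgamation:
  assumes "0 < m" "r \<le> n"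
  shows "verts (amalgamation m n r) = {0} \<times> {..<r} \<union> {..<m} \<times> {r..<n}"
proof
  show "verts (amalgamation m n r) \<subseteq> {0} \<times> {..<r} \<union> {..<m} \<times> {r..<n}"
    using assms
    by (auto simp: amalgamation_def map_graph_def disjoint_copies_def complete_graph_def verts_def
        split: if_splits)
  have eq: "verts (amalgamation m n r) =
      (\<lambda>(i, j). if j < r then (0, j) else (i, j)) ` ({..<m} \<times> {..<n})"
    by (simp add: amalgamation_def map_graph_def disjoint_copies_def complete_graph_def verts_def)
  show "{0} \<times> {..<r} \<union> {..<m} \<times> {r..<n} \<subseteq> verts (amalgamation m n r)"
  proof
    fix p assume "p \<in> {0} \<times> {..<r} \<union> {..<m} \<times> {r..<n}"
    then have "p = (case p of (i, j) \<Rightarrow> if j < r then (0, j) else (i, j))"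
      and "p \<in> {..<m} \<times> {..<n}"
      using assms by (auto split: if_splits)
    then show "p \<in> verts (amalgamation m n r)"
      unfolding eq by (rule image_eqI)
  qed
qed

lemma edges_amalgamation_iff:
  assumes m: "0 < m" and r: "r \<le> n"
  shows "{u, v} \<in> edges (amalgamation m n r) \<longleftrightarrow>
    u \<in> verts (amalgamation m n r) \<and> v \<in> verts (amalgamation m n r) \<and> u \<noteq> v \<and>
    (snd u < r \<or> snd v < r \<or> fst u = fst v)"
    (is "?L \<longleftrightarrow> ?R")
proof -
  let ?f = "\<lambda>(i::nat, j::nat). if j < r then (0, j) else (i, j)"
  have L: "?L \<longleftrightarrow> (\<exists>i<m. \<exists>e. e \<subseteq> {..<n} \<and> card e = 2 \<and> {u, v} = ?f ` Pair i ` e)"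
    by (auto simp: amalgamation_def map_graph_def disjoint_copies_def complete_graph_def
        edges_def image_iff)
  show ?thesis
  proof
    assume ?L
    then obtain i e where i: "i < m" and e: "e \<subseteq> {..<n}" "card e = 2" "{u, v} = ?f ` Pair i ` e"
      unfolding L by blast
    then obtain a b where ab: "e = {a, b}" "a \<noteq> b"
      by (auto simp: card_2_iff)
    have "a < n" "b < n" using e(1) ab(1) by auto
    moreover have "{u, v} = {?f (i, a), ?f (i, b)}" using e(3) ab(1) by simp
    ultimately show ?R
      using i ab(2) m r unfolding verts_amalgamation[OF m r] doubleton_eq_iff
      by (auto split: if_splits)
  next
    assume R: ?R
    obtain i a k b where uv: "u = (i, a)" "v = (k, b)" by (cases u, cases v)
    define p where "p = (if a < r then k else i)"
    have "p < m" "a < n" "b < n" "a \<noteq> b" "?f (p, a) = u" "?f (p, b) = v"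
      using R m r unfolding verts_amalgamation[OF m r] uv p_def by (auto split: if_splits)
    then show ?L
      unfolding L by (intro exI[of _ p] conjI exI[of _ "{a, b}"]) auto
  qed
qed

end

theory Submission
  imports Defs "HOL-Library.Nat_Bijection"
begin

text \<open>Write \<open>N = n + 1\<close>, which is odd, and \<open>R = r + 1\<close>. Joining a new vertex to \<open>A(mK\<^sub>n, K\<^sub>r)\<close>
  enlarges the shared clique by that vertex, so the join is isomorphic to \<open>A(mK\<^sub>N, K\<^sub>R)\<close>
  (\<open>amalgamation_Suc_Suc\<close>), and \<open>chi_la\<close> is an isomorphism invariant (\<open>chi_la_map_graph\<close>). Each
  copy of \<open>K\<^sub>N\<close> is a clique, whose vertices have distinct sums; hence at least \<open>N\<close> sums occur. It
  remains to find a labeling in which the sum at \<open>(i, j)\<close> depends only on the level \<open>j\<close>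
  and in which distinct levels have distinct sums.

  Call the pair of levels of an edge its type. The edges of one type are \<open>m\<close> in number, one for
  each copy of \<open>K\<^sub>N\<close>, except that a type inside the shared clique has a single edge. Each
  type receives a block of consecutive labels, handed out either in increasing or in decreasing
  order of the copies. A vertex outside the shared clique meets one edge of each of the \<open>N - 1\<close>
  types at its level, all in its own copy \<open>i\<close>. If half of these types are increasing and half are
  decreasing, the contributions of \<open>i\<close> cancel and its sum does not depend on \<open>i\<close>. Such a choice
  exists because \<open>N - 1 = 2h\<close> is even and level 0 belongs to the shared clique, where there is a
  single vertex per level and balance is not an issue: split the levels from 1 to \<open>2h\<close> into two
  halves and let the increasing types be those that join the halves. Every level other than 0
  then lies in \<open>h\<close> increasing types and \<open>h\<close> decreasing ones
  (\<open>card_rising\<close>, \<open>vertex_sum_copy_independent\<close>).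

  This leaves the order of the blocks free. They are arranged so that replacing a level in a type
  by a smaller one moves the block up. Then every label at a lower level beats the
  corresponding label at a higher level, and a shared vertex, which meets all copies of a type
  rather than one, only gains by that. So the sums strictly decrease with the level
  (\<open>vertex_sum_level_less\<close>).\<close>

section \<open>Isomorphic graphs\<close>

lemma verts_map_graph: "verts (map_graph f G) = f ` verts G"
  by (simp add: map_graph_def verts_def)

lemma edges_map_graph: "edges (map_graph f G) = image f ` edges G"
  by (simp add: map_graph_def edges_def)

lemma inj_on_image_edges:
  assumes "finite_simple_graph G" and "inj_on f (verts G)"
  shows "inj_on (image f) (edges G)"
  using inj_on_subset[OF inj_on_image_Pow[OF assms(2)]] assms(1)
  by (auto simp: finite_simple_graph_def)

lemma finite_simple_graph_map_graph:
  assumes "finite_simple_graph G" and "inj_on f (verts G)"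
  shows "finite_simple_graph (map_graph f G)"
proof -
  have "f ` e \<subseteq> f ` verts G \<and> card (f ` e) = 2" if "e \<in> edges G" for e
    using assms(1) that inj_on_subset[OF assms(2), of e]
    by (auto simp: finite_simple_graph_def card_image)
  then show ?thesis
    using assms(1) by (simp add: finite_simple_graph_def verts_map_graph edges_map_graph)
qed

lemma vertex_sum_map_graph:
  assumes G: "finite_simple_graph G" and f: "inj_on f (verts G)" and u: "u \<in> verts G"
  shows "vertex_sum (map_graph f G) g (f u) = vertex_sum G (g \<circ> image f) u"
proof -
  have mem: "f u \<in> f ` e \<longleftrightarrow> u \<in> e" if "e \<in> edges G" for e
    using G f u that by (intro inj_on_image_mem_iff) (auto simp: finite_simple_graph_def)
  have "{e \<in> edges (map_graph f G). f u \<in> e} = image f ` {e \<in> edges G. u \<in> e}"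
    unfolding edges_map_graph using mem by blast
  moreover have "inj_on (image f) {e \<in> edges G. u \<in> e}"
    by (rule inj_on_subset[OF inj_on_image_edges[OF G f]]) auto
  ultimately show ?thesis
    by (simp add: vertex_sum_def sum.reindex)
qed

lemma local_antimagic_labeling_map_graph:
  assumes G: "finite_simple_graph G" and f: "inj_on f (verts G)"
    and g: "local_antimagic_labeling (map_graph f G) g"
  shows "local_antimagic_labeling G (g \<circ> image f)"
proof -
  have "bij_betw (image f) (edges G) (edges (map_graph f G))"
    using inj_on_image_edges[OF G f] by (simp add: bij_betw_def map_graph_def edges_def)
  then have bij: "bij_betw (g \<circ> image f) (edges G) {1..card (edges G)}"
    using g by (metis bij_betw_trans bij_betw_same_card local_antimagic_labeling_def)
  have "vertex_sum G (g \<circ> image f) u \<noteq> vertex_sum G (g \<circ> image f) v"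
    if e: "{u, v} \<in> edges G" for u v
  proof -
    have uv: "u \<in> verts G" "v \<in> verts G"
      using G e by (auto simp: finite_simple_graph_def)
    have "f ` {u, v} \<in> edges (map_graph f G)"
      using e unfolding map_graph_def edges_def snd_conv by (rule imageI)
    then show ?thesis
      using g uv by (simp add: local_antimagic_labeling_def
          vertex_sum_map_graph[OF G f, symmetric])
  qed
  with bij show ?thesis by (simp add: local_antimagic_labeling_def)
qed

text \<open>Labelings pull back along \<open>f\<close> with the same number of sums. Used for \<open>f\<close> and for its inverse,
  this gives equality of the two sets.\<close>

lemma colour_counts_map_graph_subset:
  assumes G: "finite_simple_graph G" and f: "inj_on f (verts G)"
  shows "{card (vertex_sum (map_graph f G) g ` verts (map_graph f G)) | g.
            local_antimagic_labeling (map_graph f G) g}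
         \<subseteq> {card (vertex_sum G g ` verts G) | g. local_antimagic_labeling G g}"
proof -
  have "vertex_sum (map_graph f G) g ` verts (map_graph f G)
      = vertex_sum G (g \<circ> image f) ` verts G" for g
    using vertex_sum_map_graph[OF G f, of _ g]
    by (auto simp: map_graph_def verts_def image_image)
  then show ?thesis
    using local_antimagic_labeling_map_graph[OF G f] by fastforce
qed

lemma chi_la_map_graph:
  assumes G: "finite_simple_graph G" and f: "inj_on f (verts G)"
  shows "chi_la (map_graph f G) = chi_la G"
proof -
  let ?H = "map_graph f G" and ?f' = "inv_into (verts G) f"
  have "?f' ` f ` e = e" if "e \<in> edges G" for e
    using that G by (intro inv_into_image_cancel[OF f]) (auto simp: finite_simple_graph_def)
  then have "image ?f' ` image f ` edges G = edges G"
    unfolding image_image by simp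
  moreover have "?f' ` f ` verts G = verts G"
    by (rule inv_into_image_cancel[OF f]) simp
  ultimately have "map_graph ?f' ?H = G"
    by (simp add: map_graph_def verts_def edges_def)
  moreover have "inj_on ?f' (verts ?H)"
    unfolding verts_map_graph by (rule inj_on_inv_into) simp
  ultimately have "{card (vertex_sum G g ` verts G) | g. local_antimagic_labeling G g}
      \<subseteq> {card (vertex_sum ?H g ` verts ?H) | g. local_antimagic_labeling ?H g}"
    using colour_counts_map_graph_subset[OF finite_simple_graph_map_graph[OF G f], of ?f'] by simp
  then show ?thesis
    unfolding chi_la_def
    by (intro arg_cong[where f = Inf] subset_antisym colour_counts_map_graph_subset[OF G f])
qed

text \<open>The join vertex takes the place of level 0 of the larger amalgamation, and all other levels
  move up by one; the vertices below level \<open>Suc r\<close> are then the old shared clique together with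
  the join vertex.\<close>

lemma amalgamation_Suc_Suc:
  assumes m: "0 < m" and r: "r \<le> n"
  shows "amalgamation m (Suc n) (Suc r) =
    map_graph (case_sum (\<lambda>(i, j). (i, Suc j)) (\<lambda>_. (0, 0)))
      (graph_join (amalgamation m n r) (complete_graph 1))"
    (is "?A = map_graph ?f ?J")
proof -
  let ?shift = "\<lambda>(i, j). (i, Suc j) :: nat \<times> nat"
  have vK: "verts (complete_graph 1) = {0}"
    by (auto simp: complete_graph_def verts_def)
  have eK: "edges (complete_graph 1) = {}"
    by (auto simp: complete_graph_def edges_def lessThan_Suc dest: subset_singletonD)
  have vJ: "verts ?J = verts (amalgamation m n r) <+> {0}"
    unfolding graph_join_def vK by (simp add: verts_def)
  have eJ: "edges ?J = image Inl ` edges (amalgamation m n r) \<union>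
      {{Inl u, Inr 0} | u. u \<in> verts (amalgamation m n r)}"
    unfolding graph_join_def using vK eK by (simp add: edges_def)
  have V: "verts ?A = verts (map_graph ?f ?J)"
  proof -
    have "verts (map_graph ?f ?J) = insert (0, 0) (?shift ` verts (amalgamation m n r))"
      unfolding verts_map_graph vJ by (simp add: Plus_def image_Un image_image)
    moreover have "(i, j) \<in> verts ?A \<longleftrightarrow> (i, j) \<in> insert (0, 0) (?shift ` verts (amalgamation m n r))"
      for i j
      using m r by (cases j) (auto simp: verts_amalgamation intro: image_eqI[of _ _ "(i, j - 1)"])
    ultimately show ?thesis by (auto simp del: insert_iff)
  qed
  have shift_vert: "?shift u \<in> verts ?A \<longleftrightarrow> u \<in> verts (amalgamation m n r)" for u
    using m r by (cases u) (auto simp: verts_amalgamation)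
  have shift_edge: "{?shift u, ?shift v} \<in> edges ?A \<longleftrightarrow> {u, v} \<in> edges (amalgamation m n r)" for u v
    using m r by (cases u; cases v) (auto simp: edges_amalgamation_iff shift_vert[symmetric])
  have apex_edge: "{?shift u, (0, 0)} \<in> edges ?A \<longleftrightarrow> u \<in> verts (amalgamation m n r)" for u
    using m r by (cases u) (auto simp: edges_amalgamation_iff verts_amalgamation)
  have eH: "edges (map_graph ?f ?J) = image ?shift ` edges (amalgamation m n r) \<union>
      {{?shift u, (0, 0)} | u. u \<in> verts (amalgamation m n r)}"
  proof -
    have "image ?f ` {{Inl u, Inr 0} | u. u \<in> verts (amalgamation m n r)} =
        {{?shift u, (0, 0)} | u. u \<in> verts (amalgamation m n r)}"
      unfolding setcompr_eq_image by (simp add: image_image)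
    then show ?thesis
      unfolding edges_map_graph eJ image_Un by (simp add: image_image)
  qed
  have "edges ?A = edges (map_graph ?f ?J)"
  proof (intro equalityI subsetI)
    fix e assume e: "e \<in> edges ?A"
    then obtain x y where xy: "e = {x, y}" "x \<noteq> y"
      using finite_simple_graph_amalgamation[of m "Suc n" "Suc r"]
      by (auto simp: finite_simple_graph_def card_2_iff)
    then have "x \<in> verts ?A" "y \<in> verts ?A"
      using e m r by (simp_all add: edges_amalgamation_iff)
    moreover have "z = (0, 0) \<or> (\<exists>u. z = ?shift u)" if "z \<in> verts ?A" for z
      using that m r by (cases z; cases "snd z") (auto simp: verts_amalgamation)
    ultimately consider
        u v where "x = ?shift u" "y = ?shift v"
      | u where "x = ?shift u" "y = (0, 0)"
      | u where "x = (0, 0)" "y = ?shift u"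
      using xy(2) by metis
    then show "e \<in> edges (map_graph ?f ?J)"
    proof cases
      case 1
      then have "e = ?shift ` {u, v}" "{u, v} \<in> edges (amalgamation m n r)"
        using e xy(1) shift_edge[of u v] by simp_all
      then show ?thesis unfolding eH by blast
    next
      case 2
      then show ?thesis using e xy(1) apex_edge[of u] unfolding eH by blast
    next
      case 3
      then have "e = {?shift u, (0, 0)}" using xy(1) by auto
      then show ?thesis using e apex_edge[of u] unfolding eH by blast
    qed
  next
    fix e assume "e \<in> edges (map_graph ?f ?J)"
    then consider u v where "e = ?shift ` {u, v}" "{u, v} \<in> edges (amalgamation m n r)"
      | u where "e = {?shift u, (0, 0)}" "u \<in> verts (amalgamation m n r)"
      using finite_simple_graph_amalgamation[of m n r] unfolding eH
      by (auto simp: finite_simple_graph_def card_2_iff)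
    then show "e \<in> edges ?A"
      by cases (use shift_edge apex_edge in simp_all)
  qed
  with V show ?thesis
    by (simp add: verts_def edges_def prod_eq_iff)
qed

section \<open>The clique bound\<close>

lemma card_clique_le_colours:
  assumes g: "local_antimagic_labeling G g" and "finite (verts G)" and C: "C \<subseteq> verts G"
    and adj: "\<And>u v. u \<in> C \<Longrightarrow> v \<in> C \<Longrightarrow> u \<noteq> v \<Longrightarrow> {u, v} \<in> edges G"
  shows "card C \<le> card (vertex_sum G g ` verts G)"
proof -
  have "inj_on (vertex_sum G g) C"
    using g adj by (meson inj_onI local_antimagic_labeling_def)
  then have "card C = card (vertex_sum G g ` C)"
    by (simp add: card_image)
  also have "\<dots> \<le> card (vertex_sum G g ` verts G)"
    using assms by (intro card_mono) auto
  finally show ?thesis .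
qed

section \<open>Consecutive blocks of labels\<close>

text \<open>The number of labels in front of the block of \<open>t\<close>, when the blocks of sizes \<open>s\<close> follow one
  another in decreasing order of \<open>key\<close>.\<close>

definition offset :: "('a \<Rightarrow> nat) \<Rightarrow> ('a \<Rightarrow> nat) \<Rightarrow> 'a set \<Rightarrow> 'a \<Rightarrow> nat" where
  "offset key s T t = (\<Sum>u \<in> {u \<in> T. key t < key u}. s u)"

lemma offset_add_size_le:
  assumes "finite T" "u \<in> T" "key t < key u"
  shows "offset key s T u + s u \<le> offset key s T t"
proof -
  have "offset key s T u + s u = sum s (insert u {v \<in> T. key u < key v})"
    using assms(1) by (simp add: offset_def)
  also have "\<dots> \<le> offset key s T t"
    unfolding offset_def using assms by (intro sum_mono2) auto
  finally show ?thesis .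
qed

lemma offset_add_size_le_sum:
  assumes "finite T" "t \<in> T"
  shows "offset key s T t + s t \<le> sum s T"
proof -
  have "offset key s T t + s t = sum s (insert t {v \<in> T. key t < key v})"
    using assms(1) by (simp add: offset_def)
  also have "\<dots> \<le> sum s T"
    using assms by (intro sum_mono2) auto
  finally show ?thesis .
qed

text \<open>Here \<open>p t\<close> permutes the labels inside the block of \<open>t\<close>. Blocks with different keys are disjoint
  by \<open>offset_add_size_le\<close>, and an injection into a set of the same size is onto.\<close>

lemma bij_betw_blocks:
  assumes T: "finite T" and key: "inj_on key T"
    and p_less: "\<And>t i. t \<in> T \<Longrightarrow> i < s t \<Longrightarrow> p t i < s t"
    and p_inj: "\<And>t. t \<in> T \<Longrightarrow> inj_on (p t) {..<s t}"
  shows "bij_betw (\<lambda>(t, i). Suc (offset key s T t + p t i))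
    (SIGMA t:T. {..<s t}) {1..sum s T}"
proof -
  let ?l = "\<lambda>t i. Suc (offset key s T t + p t i)"
  let ?S = "SIGMA t:T. {..<s t}"
  have less: "?l u k < ?l t i" if "u \<in> T" "k < s u" "key t < key u" for t u i k
    using p_less[OF that(1,2)] offset_add_size_le[OF T that(1,3), of s] by linarith
  have inj: "inj_on (\<lambda>(t, i). ?l t i) ?S"
  proof (rule inj_onI, clarsimp)
    fix t i u k
    assume tu: "t \<in> T" "i < s t" "u \<in> T" "k < s u"
      and eq: "offset key s T t + p t i = offset key s T u + p u k"
    have "\<not> key t < key u" "\<not> key u < key t"
      using less[of u k t i] less[of t i u k] tu eq by auto
    then have "t = u" using key tu by (auto simp: inj_on_def)
    then show "t = u \<and> i = k" using eq p_inj tu by (auto simp: inj_on_def)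
  qed
  have "(\<lambda>(t, i). ?l t i) ` ?S \<subseteq> {1..sum s T}"
  proof clarsimp
    fix t i assume "t \<in> T" "i < s t"
    then show "Suc (offset key s T t + p t i) \<le> sum s T"
      using p_less[of t i] offset_add_size_le_sum[OF T, of t key s] by linarith
  qed
  moreover have "card ((\<lambda>(t, i). ?l t i) ` ?S) = card {1..sum s T}"
    using inj T by (simp add: card_image)
  ultimately show ?thesis
    using inj unfolding bij_betw_def by (intro conjI card_subset_eq) simp_all
qed

section \<open>A labeling of the amalgamation of odd complete graphs\<close>

locale odd_amalgamation =
  fixes m h R :: nat
  assumes m: "0 < m" and h: "0 < h" and R0: "0 < R" and R: "R \<le> 2 * h + 1"
begin

definition N :: nat where
  "N = 2 * h + 1"

definition A :: "(nat \<times> nat) ugraph" where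
  "A = amalgamation m N R"

text \<open>The vertex of the amalgamation that represents level \<open>j\<close> of copy \<open>i\<close>.\<close>

definition place :: "nat \<Rightarrow> nat \<Rightarrow> nat \<times> nat" where
  "place i j = (if j < R then (0, j) else (i, j))"

definition types :: "nat set set" where
  "types = {t. t \<subseteq> {..<N} \<and> card t = 2}"

text \<open>The number of edges of type \<open>t\<close> in the amalgamation.\<close>

definition copies :: "nat set \<Rightarrow> nat" where
  "copies t = (if t \<subseteq> {..<R} then 1 else m)"

text \<open>The types whose labels increase with the copy: the edges of the complete bipartite graph
  between the two halves of the nonzero levels. This graph is \<open>h\<close>-regular on those levels, which
  is half of their degree \<open>2 * h\<close> in the complete graph.\<close>

definition rising :: "nat set \<Rightarrow> bool" where
  "rising t \<longleftrightarrow> t \<inter> {1..h} \<noteq> {} \<and> t \<inter> {h<..} \<noteq> {}"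

text \<open>On a type, \<open>set_encode {j, k} = 2 ^ j + 2 ^ k\<close> is an injective key that increases in both
  levels, so larger levels get smaller labels.\<close>

abbreviation off :: "nat set \<Rightarrow> nat" where
  "off \<equiv> offset set_encode copies types"

definition pos :: "nat set \<Rightarrow> nat \<Rightarrow> nat" where
  "pos t i = (if rising t then i else copies t - 1 - i)"

definition lab :: "nat set \<Rightarrow> nat \<Rightarrow> nat" where
  "lab t i = Suc (off t + pos t i)"

text \<open>The pairs of a type and a copy that name each edge exactly once: a type inside the shared
  clique is taken in copy 0 only.\<close>

abbreviation slots :: "(nat set \<times> nat) set" where
  "slots \<equiv> SIGMA t:types. {..<copies t}"

definition edge :: "nat set \<times> nat \<Rightarrow> (nat \<times> nat) set" where
  "edge = (\<lambda>(t, i). place i ` t)"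

definition labeling :: "(nat \<times> nat) set \<Rightarrow> nat" where
  "labeling = case_prod lab \<circ> the_inv_into slots edge"

lemma R_le_N: "R \<le> N"
  using R by (simp add: N_def)

lemma verts_A: "(i, j) \<in> verts A \<longleftrightarrow> j < N \<and> i < m \<and> (j < R \<longrightarrow> i = 0)"
  using m R_le_N by (auto simp: A_def verts_amalgamation)

lemma edges_A_iff:
  "{u, v} \<in> edges A \<longleftrightarrow>
    u \<in> verts A \<and> v \<in> verts A \<and> u \<noteq> v \<and> (snd u < R \<or> snd v < R \<or> fst u = fst v)"
  using m R_le_N by (simp add: A_def edges_amalgamation_iff)

lemma finite_types: "finite types"
  by (simp add: types_def)

lemma pair_in_types: "{j, k} \<in> types \<longleftrightarrow> j < N \<and> k < N \<and> j \<noteq> k"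
  by (auto simp: types_def)

lemma typesE:
  assumes "t \<in> types" "j \<in> t"
  obtains k where "t = {j, k}" "k \<in> {..<N} - {j}"
  using assms unfolding types_def card_2_iff by blast

lemma copies_pos: "0 < copies t"
  using m by (simp add: copies_def)

lemma pos_less: "i < copies t \<Longrightarrow> pos t i < copies t"
  by (simp add: pos_def)

lemma bij_lab: "bij_betw (case_prod lab) slots {1..sum copies types}"
proof -
  have "inj_on set_encode types"
    by (rule inj_on_subset[OF inj_on_set_encode]) (auto simp: types_def intro: finite_subset)
  moreover have "inj_on (pos t) {..<copies t}" for t
    by (auto simp: inj_on_def pos_def)
  ultimately show ?thesis
    unfolding lab_def by (intro bij_betw_blocks finite_types pos_less)
qed

text \<open>The blocks of \<open>{j, l}\<close> and \<open>{k, l}\<close> are disjoint, so the copies are immaterial for the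
  comparison.\<close>

lemma lab_less:
  assumes "k < j" "j < N" "l < N" "l \<noteq> j" "l \<noteq> k" "i < copies {j, l}"
  shows "lab {j, l} i < lab {k, l} i'"
proof -
  have "set_encode {k, l} < set_encode {j, l}"
    using assms by (simp add: set_encode_def)
  from offset_add_size_le[OF finite_types _ this, of copies]
  have "off {j, l} + copies {j, l} \<le> off {k, l}"
    using assms by (simp add: pair_in_types)
  moreover have "pos {j, l} i < copies {j, l}"
    using assms(6) by (rule pos_less)
  ultimately show ?thesis by (simp add: lab_def)
qed

lemma bij_edge: "bij_betw edge slots (edges A)"
proof -
  have "inj_on edge slots"
  proof (rule inj_onI, clarsimp simp: edge_def)
    fix t i u k
    assume t: "t \<in> types" "i < copies t" and u: "u \<in> types" "k < copies u"
      and eq: "place i ` t = place k ` u"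
    have "snd ` place i ` t = t" for t i
      unfolding image_image by (auto simp: place_def)
    then have tu: "t = u" using eq by metis
    show "t = u \<and> i = k"
    proof (cases "t \<subseteq> {..<R}")
      case True
      then show ?thesis using t u tu by (simp add: copies_def)
    next
      case False
      then obtain j where "j \<in> t" "\<not> j < R" by auto
      then have "(i, j) \<in> place i ` t" by (intro image_eqI[of _ _ j]) (simp_all add: place_def)
      then have "(i, j) \<in> place k ` u" unfolding eq .
      then have "i = k" using \<open>\<not> j < R\<close> by (auto simp: place_def split: if_splits)
      then show ?thesis using tu by simp
    qed
  qed
  moreover have "edge ` slots = edges A"
  proof -
    have place: "(\<lambda>(i, j). if j < R then (0, j) else (i, j)) ` Pair i ` t = place i ` t" for i t
      by (simp add: image_image place_def[abs_def])
    have D: "edges (disjoint_copies m (complete_graph N)) = (\<lambda>(i, t). Pair i ` t) ` ({..<m} \<times> types)"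
      by (auto simp: disjoint_copies_def complete_graph_def edges_def types_def)
    have E: "edges A = (\<lambda>(i, t). place i ` t) ` ({..<m} \<times> types)"
      unfolding A_def amalgamation_def edges_map_graph D image_image[where f = "image _"]
      by (intro image_cong refl) (clarsimp simp: place)
    have core: "place i ` t = place 0 ` t" if "t \<subseteq> {..<R}" for i t
      using that by (intro image_cong) (auto simp: place_def)
    show ?thesis
    proof (intro equalityI subsetI)
      fix e assume "e \<in> edge ` slots"
      then obtain t i where "t \<in> types" "i < copies t" "e = place i ` t"
        unfolding edge_def by auto
      moreover have "copies t \<le> m" for t using m by (simp add: copies_def)
      ultimately show "e \<in> edges A"
        unfolding E by (auto dest: less_le_trans)
    next
      fix e assume "e \<in> edges A"
      then obtain i t where it: "i < m" "t \<in> types" "e = place i ` t"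
        unfolding E by auto
      show "e \<in> edge ` slots"
      proof (cases "t \<subseteq> {..<R}")
        case True
        then have "(t, 0) \<in> slots" "e = edge (t, 0)"
          using it core[OF True, of i] by (simp_all add: copies_def edge_def)
        then show ?thesis by blast
      next
        case False
        then have "(t, i) \<in> slots" "e = edge (t, i)"
          using it by (simp_all add: copies_def edge_def)
        then show ?thesis by blast
      qed
    qed
  qed
  ultimately show ?thesis by (simp add: bij_betw_def)
qed

lemma labeling_edge: "x \<in> slots \<Longrightarrow> labeling (edge x) = case_prod lab x"
  using bij_edge by (simp add: labeling_def the_inv_into_f_f bij_betw_def)

lemma bij_labeling: "bij_betw labeling (edges A) {1..card (edges A)}"
proof -
  have "card (edges A) = sum copies types"
    using bij_betw_same_card[OF bij_edge] finite_types by simp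
  then show ?thesis
    unfolding labeling_def
    using bij_betw_trans[OF bij_betw_the_inv_into[OF bij_edge] bij_lab] by simp
qed

text \<open>A shared vertex lies on all edges of each type at its level, any other vertex only on the one
  in its own copy.\<close>

lemma vertex_sum_labeling:
  assumes v: "(i, j) \<in> verts A"
  shows "vertex_sum A labeling (i, j) =
    (\<Sum>k \<in> {..<N} - {j}. \<Sum>l \<in> (if j < R then {..<copies {j, k}} else {i}). lab {j, k} l)"
proof -
  let ?K = "{..<N} - {j}"
  let ?I = "\<lambda>k. if j < R then {..<copies {j, k}} else {i}"
  let ?e = "\<lambda>(k, l). edge ({j, k}, l)"
  note ij = v[unfolded verts_A]
  have sub: "(\<lambda>(k, l). ({j, k}, l)) ` (SIGMA k:?K. ?I k) \<subseteq> slots"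
    using ij by (auto simp: pair_in_types copies_def split: if_splits)
  have "inj_on (\<lambda>(k, l). ({j, k}, l)) (SIGMA k:?K. ?I k)"
    by (auto simp: inj_on_def doubleton_eq_iff)
  then have "inj_on (edge \<circ> (\<lambda>(k, l). ({j, k}, l))) (SIGMA k:?K. ?I k)"
    using bij_edge sub by (auto simp: bij_betw_def intro!: comp_inj_on intro: inj_on_subset)
  then have inj: "inj_on ?e (SIGMA k:?K. ?I k)"
    by (simp add: o_def case_prod_unfold)
  have "{e \<in> edges A. (i, j) \<in> e} = ?e ` (SIGMA k:?K. ?I k)"
  proof (intro equalityI subsetI)
    fix e assume "e \<in> {e \<in> edges A. (i, j) \<in> e}"
    moreover from this obtain x where "x \<in> slots" "e = edge x"
      using bij_edge unfolding bij_betw_def by blast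
    ultimately obtain t l where t: "t \<in> types" "l < copies t" "e = edge (t, l)"
      "(i, j) \<in> place l ` t"
      by (cases x) (auto simp: edge_def)
    then have "j \<in> t" by (auto simp: place_def split: if_splits)
    then obtain k where k: "t = {j, k}" "k \<in> ?K" using typesE t(1) by blast
    have "l \<in> ?I k" using t k by (auto simp: place_def split: if_splits)
    then show "e \<in> ?e ` (SIGMA k:?K. ?I k)" using t k by force
  next
    fix e assume "e \<in> ?e ` (SIGMA k:?K. ?I k)"
    then obtain k l where kl: "k \<in> ?K" "l \<in> ?I k" "e = edge ({j, k}, l)" by auto
    then have "({j, k}, l) \<in> slots" using sub by auto
    then have "e \<in> edges A" using kl bij_edge by (auto simp: bij_betw_def)
    moreover have "(i, j) \<in> e"
      using kl ij by (auto simp: edge_def place_def split: if_splits)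
    ultimately show "e \<in> {e \<in> edges A. (i, j) \<in> e}" by simp
  qed
  then have "vertex_sum A labeling (i, j) =
      (\<Sum>x \<in> (SIGMA k:?K. ?I k). labeling (?e x))"
    using inj by (simp add: vertex_sum_def sum.reindex)
  also have "\<dots> = (\<Sum>(k, l) \<in> (SIGMA k:?K. ?I k). lab {j, k} l)"
    using sub by (intro sum.cong refl) (auto simp: labeling_edge)
  also have "\<dots> = (\<Sum>k \<in> ?K. \<Sum>l \<in> ?I k. lab {j, k} l)"
    by (subst sum.Sigma) auto
  finally show ?thesis .
qed

lemma card_rising:
  assumes "0 < j" "j < N"
  shows "card {k \<in> {..<N} - {j}. rising {j, k}} = h"
    and "card {k \<in> {..<N} - {j}. \<not> rising {j, k}} = h"
proof -
  have "{k \<in> {..<N} - {j}. rising {j, k}} = (if j \<le> h then {h<..2 * h} else {1..h})"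
    using assms by (auto simp: rising_def N_def)
  then show r: "card {k \<in> {..<N} - {j}. rising {j, k}} = h" by simp
  have "{k \<in> {..<N} - {j}. \<not> rising {j, k}} = ({..<N} - {j}) - {k \<in> {..<N} - {j}. rising {j, k}}"
    by auto
  also have "card \<dots> = card ({..<N} - {j}) - card {k \<in> {..<N} - {j}. rising {j, k}}"
    by (rule card_Diff_subset) auto
  also have "\<dots> = h"
    using assms unfolding r by (simp add: N_def)
  finally show "card {k \<in> {..<N} - {j}. \<not> rising {j, k}} = h" .
qed

text \<open>Outside the shared clique, the positions inside the \<open>2 * h\<close> blocks that are met add up to
  \<open>h * i + h * (m - 1 - i) = h * (m - 1)\<close>.\<close>

lemma vertex_sum_copy_independent:
  assumes "(i, j) \<in> verts A" "(i', j) \<in> verts A"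
  shows "vertex_sum A labeling (i, j) = vertex_sum A labeling (i', j)"
proof (cases "j < R")
  case True
  then show ?thesis using assms by (simp add: vertex_sum_labeling)
next
  case False
  have "vertex_sum A labeling (i, j) =
      (\<Sum>k \<in> {..<N} - {j}. Suc (off {j, k})) + h * (m - 1)"
    if v: "(i, j) \<in> verts A" for i
  proof -
    have ij: "j < N" "i < m" using v by (auto simp: verts_A)
    have "copies {j, k} = m" for k using False by (simp add: copies_def)
    then have "vertex_sum A labeling (i, j) =
        (\<Sum>k \<in> {..<N} - {j}. Suc (off {j, k}) + (if rising {j, k} then i else m - 1 - i))"
      using v False by (simp add: vertex_sum_labeling lab_def pos_def cong: if_cong)
    also have "\<dots> = (\<Sum>k \<in> {..<N} - {j}. Suc (off {j, k})) +
        (\<Sum>k \<in> {..<N} - {j}. if rising {j, k} then i else m - 1 - i)"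
      by (rule sum.distrib)
    also have "(\<Sum>k \<in> {..<N} - {j}. if rising {j, k} then i else m - 1 - i) =
        h * i + h * (m - 1 - i)"
      using card_rising[of j] False R0 ij
      by (simp add: sum.If_cases Int_def Collect_neg_eq[symmetric] conj_commute)
    also have "\<dots> = h * (m - 1)"
      using ij by (simp flip: distrib_left)
    finally show ?thesis .
  qed
  then show ?thesis using assms by simp
qed

text \<open>Compare the contributions of a third level \<open>k\<close> to both sums: they are strictly ordered by
  \<open>lab_less\<close>, and at least one such \<open>k\<close> exists as \<open>N \<ge> 3\<close>. The type \<open>{j, j'}\<close> itself contributes the
  same labels to both, except that a shared vertex \<open>j\<close> collects the labels of all copies
  and \<open>j'\<close> perhaps only one of them.\<close>

lemma vertex_sum_level_less:
  assumes "j < j'" "j' < N"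
  shows "vertex_sum A labeling (0, j') < vertex_sum A labeling (0, j)"
proof -
  let ?w = "\<lambda>j k. \<Sum>l \<in> (if j < R then {..<copies {j, k}} else {0}). lab {j, k} l"
  let ?K = "{..<N} - {j, j'}"
  have first: "lab {j, k} 0 \<le> ?w j k" for j k
    using copies_pos[of "{j, k}"] by (auto intro: member_le_sum)
  have lt: "?w j' k < ?w j k" if "k \<in> ?K" for k
  proof (cases "j' < R")
    case True
    then have "copies {j', k} = copies {j, k}" using assms by (simp add: copies_def)
    then show ?thesis
      using True assms that copies_pos by (auto intro!: sum_strict_mono lab_less)
  next
    case False
    then have "?w j' k = lab {j', k} 0" by simp
    also have "\<dots> < lab {j, k} 0" using assms that copies_pos by (intro lab_less) auto
    finally show ?thesis using first[of j k] by linarith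
  qed
  have le: "?w j' j \<le> ?w j j'"
  proof (cases "j' < R")
    case True
    then show ?thesis using assms by (simp add: insert_commute)
  next
    case False
    then show ?thesis using first[of j j'] by (simp add: insert_commute)
  qed
  have v: "(0, j) \<in> verts A" "(0, j') \<in> verts A" using assms m by (auto simp: verts_A)
  have K: "{..<N} - {j} = insert j' ?K" "{..<N} - {j'} = insert j ?K"
    using assms by auto
  have "2 < N" using h unfolding N_def by linarith
  then have "card {j, j'} < card {..<N}" using assms by simp
  then have "?K \<noteq> {}"
    by (metis Diff_eq_empty_iff card_mono finite.emptyI finite_insert leD)
  then have "sum (?w j') ?K < sum (?w j) ?K"
    using lt by (intro sum_strict_mono) auto
  moreover have "vertex_sum A labeling (0, j) = ?w j j' + sum (?w j) ?K"
    unfolding vertex_sum_labeling[OF v(1)] K(1) by (rule sum.insert) simp_all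
  moreover have "vertex_sum A labeling (0, j') = ?w j' j + sum (?w j') ?K"
    unfolding vertex_sum_labeling[OF v(2)] K(2) by (rule sum.insert) simp_all
  ultimately show ?thesis using le by linarith
qed

lemma vertex_sum_level:
  assumes "(i, j) \<in> verts A"
  shows "vertex_sum A labeling (i, j) = vertex_sum A labeling (0, j)"
  using assms m by (intro vertex_sum_copy_independent) (auto simp: verts_A)

lemma inj_on_vertex_sum_level: "inj_on (\<lambda>j. vertex_sum A labeling (0, j)) {..<N}"
  using vertex_sum_level_less by (intro linorder_inj_onI) fastforce+

lemma local_antimagic_labeling_A: "local_antimagic_labeling A labeling"
proof -
  have "vertex_sum A labeling u \<noteq> vertex_sum A labeling v" if "{u, v} \<in> edges A" for u v
  proof -
    obtain i j k l where uv: "u = (i, j)" "v = (k, l)" by (cases u, cases v)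
    have V: "(i, j) \<in> verts A" "(k, l) \<in> verts A" and "j \<noteq> l"
      using that unfolding uv edges_A_iff by (auto simp: verts_A)
    then have "vertex_sum A labeling (0, j) \<noteq> vertex_sum A labeling (0, l)"
      using inj_on_vertex_sum_level by (auto simp: inj_on_def verts_A)
    then show ?thesis
      unfolding uv V[THEN vertex_sum_level] .
  qed
  with bij_labeling show ?thesis by (simp add: local_antimagic_labeling_def)
qed

lemma card_colours: "card (vertex_sum A labeling ` verts A) = N"
proof -
  have "vertex_sum A labeling ` verts A = (\<lambda>j. vertex_sum A labeling (0, j)) ` {..<N}"
  proof (intro equalityI subsetI)
    fix c assume "c \<in> vertex_sum A labeling ` verts A"
    then obtain i j where ij: "(i, j) \<in> verts A" "c = vertex_sum A labeling (i, j)" by auto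
    then have "c = vertex_sum A labeling (0, j)" "j \<in> {..<N}"
      using vertex_sum_level[OF ij(1)] by (simp_all add: verts_A)
    then show "c \<in> (\<lambda>j. vertex_sum A labeling (0, j)) ` {..<N}" by blast
  next
    fix c assume "c \<in> (\<lambda>j. vertex_sum A labeling (0, j)) ` {..<N}"
    then show "c \<in> vertex_sum A labeling ` verts A"
      using m by (auto simp: verts_A intro!: imageI)
  qed
  then show ?thesis using inj_on_vertex_sum_level by (simp add: card_image)
qed

lemma colours_ge:
  assumes "local_antimagic_labeling A g"
  shows "N \<le> card (vertex_sum A g ` verts A)"
proof -
  have "card ({0 :: nat} \<times> {..<N}) \<le> card (vertex_sum A g ` verts A)"
  proof (rule card_clique_le_colours[OF assms])
    show "finite (verts A)"
      using finite_simple_graph_amalgamation unfolding A_def finite_simple_graph_def by blast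
    show sub: "{0} \<times> {..<N} \<subseteq> verts A"
      using m by (auto simp: verts_A)
    show "{u, v} \<in> edges A" if "u \<in> {0} \<times> {..<N}" "v \<in> {0} \<times> {..<N}" "u \<noteq> v" for u v
      using that sub by (auto simp: edges_A_iff)
  qed
  then show ?thesis by (simp add: card_cartesian_product)
qed

lemma chi_la_A: "chi_la A = N"
  unfolding chi_la_def
proof (rule cInf_eq_minimum)
  show "N \<in> {card (vertex_sum A g ` verts A) |g. local_antimagic_labeling A g}"
    using local_antimagic_labeling_A card_colours by (auto intro!: exI[of _ labeling])
qed (use colours_ge in auto)

lemmas chi_la_amalgamation = chi_la_A[unfolded A_def N_def]

end

theorem corollary2p4:
  fixes m n r :: nat
  assumes "m \<ge> 2" and "n > 0" and "even n" and "r < n"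
  shows "chi_la (amalgamation m (n + 1) (r + 1)) =
           chi_la (graph_join (amalgamation m n r) (complete_graph 1)) \<and>
         chi_la (graph_join (amalgamation m n r) (complete_graph 1)) = n + 1"
proof -
  let ?J = "graph_join (amalgamation m n r) (complete_graph 1)"
  let ?f = "case_sum (\<lambda>(i, j). (i, Suc j)) (\<lambda>_. (0, 0)) :: nat \<times> nat + nat \<Rightarrow> nat \<times> nat"
  obtain h where n_eq: "n = 2 * h" using assms(3) by (elim evenE)
  interpret odd_amalgamation m h "r + 1"
    using assms n_eq by unfold_locales auto
  have "finite_simple_graph ?J"
    by (intro finite_simple_graph_join finite_simple_graph_amalgamation finite_simple_graph_complete)
  moreover have "inj_on ?f (verts ?J)"
    by (auto simp: inj_on_def graph_join_def verts_def complete_graph_def)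
  ultimately have "chi_la (map_graph ?f ?J) = chi_la ?J"
    by (rule chi_la_map_graph)
  moreover have "amalgamation m (n + 1) (r + 1) = map_graph ?f ?J"
    using assms amalgamation_Suc_Suc[of m r n] by simp
  moreover have "chi_la (amalgamation m (n + 1) (r + 1)) = n + 1"
    using chi_la_amalgamation by (simp only: n_eq)
  ultimately show ?thesis by simp
qed

end
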